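(* Let $K$ be a field of characteristic zero (e.g. $K=\mathbb{C}$ or $K=\mathbb{C}_p$), let $t$ be an indeterminate, $D=\frac{d}{dt}$ and $\Delta=tD$ (acting on $K[t]$). Let $m\ge 2$ and let $N,P_1,\dots,P_m\in K[t]$ with $S=\deg N$ and $r_j=\deg P_j$ ($j=1,\dots,m$), where $\deg$ of the zero polynomial is $-\infty$. Assume $$S\ge 0,\qquad r_m=S+1,\qquad r_j<r_m\quad\text{for all } j=1,\dots,m-1.$$ Let $A_{0,1},\dots,A_{0,m}\in K[t]$ with $(A_{0,1},\dots,A_{0,m})\neq(0,\dots,0)$, and define polynomials $A_{n,j}\in K[t]$ for $n\ge 0$ recursively by $$A_{k+1,j}=P_jA_{k,1}+N\,\Delta A_{k,j}+N A_{k,j+1}\quad (j=1,\dots,m-1),\qquad A_{k+1,m}=P_mA_{k,1}+N\,\Delta A_{k,m},$$ for all $k\in\mathbb{N}$. Then for every $k\in\mathbb{N}$ the $m\times m$ determinant $$\det\mathcal{A}_k=\det\big(A_{k+i-1,j}\big)_{1\le i,j\le m}$$ is a nonzero polynomial.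
   Context: The polynomials $A_{n,j}$ are the coefficients of the linear forms $L_n=(N\Delta)^nL_0=A_{n,1}\Delta^{m-1}F+\dots+A_{n,m}\Delta^0F$, where $L_0=A_{0,1}\Delta^{m-1}F+\dots+A_{0,m}\Delta^0F$ and $F$ is a nonzero function satisfying $N\Delta^mF=P_1\Delta^{m-1}F+\dots+P_m\Delta^0F$; the recurrences above are obtained by applying $N\Delta$ and using this differential equation to eliminate $\Delta^mF$. $\mathbb{N}$ includes $0$. *)

theory Defs
  imports "HOL-Computational_Algebra.Polynomial" "Jordan_Normal_Form.Determinant"
begin

definition euler_deriv :: "'a::field_char_0 poly \<Rightarrow> 'a poly" where
  "euler_deriv p = [:0, 1:] * pderiv p"

text \<open>
  \<open>A k j\<close> is the \<open>j\<close>-th coefficient of the \<open>k\<close>-th linear form, for \<open>1 \<le> j \<le> m\<close>. The matrix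
  entries are indexed from 0, so entry \<open>(i, j)\<close> below is the paper's entry \<open>(i + 1, j + 1)\<close>.
\<close>
definition coeff_mat :: "nat \<Rightarrow> (nat \<Rightarrow> nat \<Rightarrow> 'a poly) \<Rightarrow> nat \<Rightarrow> 'a::field_char_0 poly mat" where
  "coeff_mat m A k = mat m m (\<lambda>(i, j). A (k + i) (j + 1))"

end

theory Submission
  imports Defs "HOL-Number_Theory.Cong"
begin

text \<open>
  Give the vector \<open>(a\<^sub>1, \<dots>, a\<^sub>m)\<close> the weight \<open>max\<^sub>j (m deg a\<^sub>j + m - j)\<close>, that is, count \<open>t\<close> with
  weight \<open>m\<close> and \<open>\<Delta>\<close> with weight \<open>1\<close>. The maximum is attained only once,
  because the candidates are distinct modulo \<open>m\<close>. The degree conditions say that the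
  recursion step has the dominant terms \<open>N a\<^bsub>j+1\<^esub>\<close> in position \<open>j\<close> and \<open>P\<^sub>m a\<^sub>1\<close> in position \<open>m\<close>, which
  raise the weight by exactly \<open>m S + 1\<close>, whereas all other terms raise it by at most \<open>m S\<close>.
  Hence \<open>m\<close> consecutive rows have weights that are pairwise distinct modulo \<open>m\<close>. Multiplying a
  row by a nonzero polynomial does not change its weight modulo \<open>m\<close>, so no cancellation is possible
  in a polynomial combination of the rows, and the rows are linearly independent.
\<close>

text \<open>Quantifying over nonzero coefficients instead of degrees keeps zero entries from
  contributing a spurious degree 0; the zero vector has no weight at all.\<close>

definition has_weight :: "nat \<Rightarrow> (nat \<Rightarrow> 'a::zero poly) \<Rightarrow> nat \<Rightarrow> bool" where
  "has_weight m a w \<longleftrightarrow>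
     (\<forall>j\<in>{1..m}. \<forall>e. coeff (a j) e \<noteq> 0 \<longrightarrow> m * e + (m - j) \<le> w) \<and>
     (\<exists>j\<in>{1..m}. \<exists>e. coeff (a j) e \<noteq> 0 \<and> m * e + (m - j) = w)"

lemma has_weightD:
  assumes "has_weight m a w" "j \<in> {1..m}" "coeff (a j) e \<noteq> 0"
  shows "m * e + (m - j) \<le> w"
  using assms unfolding has_weight_def by blast

text \<open>Within one entry the candidate grows with the exponent, so the maximum can only sit at a
  leading coefficient.\<close>

lemma has_weightE:
  assumes "has_weight m a w"
  obtains p where "p \<in> {1..m}" "a p \<noteq> 0" "m * degree (a p) + (m - p) = w"
proof -
  obtain p d where p: "p \<in> {1..m}" "coeff (a p) d \<noteq> 0" "m * d + (m - p) = w"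
    using assms unfolding has_weight_def by blast
  then have "a p \<noteq> 0"
    by auto
  then have "m * degree (a p) + (m - p) \<le> m * d + (m - p)"
    using has_weightD[OF assms p(1), of "degree (a p)"] p(3) by simp
  then have "degree (a p) \<le> d"
    using p(1) by simp
  with p(2) have "degree (a p) = d"
    using le_degree antisym by blast
  with p \<open>a p \<noteq> 0\<close> show thesis
    using that by blast
qed

lemma has_weight_exists:
  assumes "\<exists>j\<in>{1..m}. a j \<noteq> 0"
  shows "\<exists>w. has_weight m a w"
proof -
  define W where "W = {m * e + (m - j) | j e. j \<in> {1..m} \<and> coeff (a j) e \<noteq> 0}"
  have "W \<subseteq> (\<lambda>(j, e). m * e + (m - j)) ` (SIGMA j:{1..m}. {..degree (a j)})"
    unfolding W_def using le_degree by fastforce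
  then have fin: "finite W"
    by (rule finite_subset) auto
  have "W \<noteq> {}"
    using assms leading_coeff_neq_0 unfolding W_def by blast
  then have "Max W \<in> W"
    using fin by simp
  then obtain p d where pd: "p \<in> {1..m}" "coeff (a p) d \<noteq> 0" "Max W = m * d + (m - p)"
    unfolding W_def mem_Collect_eq by blast
  have "has_weight m a (Max W)"
    unfolding has_weight_def
  proof (intro conjI ballI allI impI)
    show "m * e + (m - j) \<le> Max W" if "j \<in> {1..m}" "coeff (a j) e \<noteq> 0" for j e
      by (rule Max_ge[OF fin]) (use that in \<open>unfold W_def, blast\<close>)
    show "\<exists>j\<in>{1..m}. \<exists>e. coeff (a j) e \<noteq> 0 \<and> m * e + (m - j) = Max W"
      using pd(1,2) pd(3)[symmetric] by blast
  qed
  then show ?thesis ..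
qed

text \<open>Bounds the weight gained from a multiplier by its degree, while keeping a nonzero
  coefficient of the other factor to which the weight bound applies.\<close>

lemma coeff_mult_nonzeroE:
  fixes p q :: "'a::comm_semiring_0 poly"
  assumes "coeff (p * q) e \<noteq> 0"
  obtains e' where "coeff q e' \<noteq> 0" "e \<le> degree p + e'"
proof -
  from assms obtain i where i: "i \<le> e" "coeff p i * coeff q (e - i) \<noteq> 0"
    unfolding coeff_mult by (metis (no_types, lifting) atMost_iff sum.neutral)
  then have "coeff p i \<noteq> 0" "coeff q (e - i) \<noteq> 0"
    by auto
  with i show thesis
    using le_degree[of p i] by (intro that[of "e - i"]) auto
qed

text \<open>\<Delta> preserves exponents, so it cannot raise the weight.\<close>

lemma coeff_euler_deriv: "coeff (euler_deriv p) e = of_nat e * coeff p e"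
  by (cases e) (simp_all add: euler_deriv_def coeff_pderiv)

text \<open>The position of the maximum moves cyclically: \<open>N\<close> carries it from
  \<open>p\<close> to \<open>p - 1\<close>, and \<open>P m\<close> wraps it from 1 around to
  \<open>m\<close>.\<close>

lemma has_weight_step:
  fixes N :: "'a::field_char_0 poly"
  assumes m: "m \<ge> 2" and N: "N \<noteq> 0"
    and Pm: "degree (P m) = degree N + 1"
    and Pj: "\<And>j. j \<in> {1..m - 1} \<Longrightarrow> degree (P j) < degree (P m)"
    and bj: "\<And>j. j \<in> {1..m - 1} \<Longrightarrow> b j = P j * a 1 + N * euler_deriv (a j) + N * a (j + 1)"
    and bm: "b m = P m * a 1 + N * euler_deriv (a m)"
    and w: "has_weight m a w"
  shows "has_weight m b (w + (m * degree N + 1))"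
proof -
  define S where "S = degree N"
  have Pj_le: "degree (P j) \<le> S" if "j \<in> {1..m - 1}" for j
    using Pj[OF that] Pm by (simp add: S_def)
  have scale: "m * e \<le> m * (S + e') \<Longrightarrow> m * e \<le> m * S + m * e'" for e e'
    by (simp add: algebra_simps)
  have term_P: "m * e + (m - j) \<le> w + m * S"
    if j: "j \<in> {1..m - 1}" and c: "coeff (P j * a 1) e \<noteq> 0" for j e
  proof -
    from c obtain e' where e': "coeff (a 1) e' \<noteq> 0" "e \<le> degree (P j) + e'"
      by (rule coeff_mult_nonzeroE)
    then have "m * e \<le> m * S + m * e'"
      using Pj_le[OF j] by (intro scale mult_le_mono2) auto
    moreover have "m * e' + (m - 1) \<le> w"
      using has_weightD[OF w _ e'(1)] m by simp
    moreover have "m - j \<le> m - 1"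
      using j by (intro diff_le_mono2) auto
    ultimately show ?thesis
      by linarith
  qed
  \<comment> \<open>The factor \<open>P m\<close> gains at most \<open>m * (S + 1)\<close>, and
    passing from position 1 to position \<open>m\<close> loses \<open>m - 1\<close>, which leaves
    \<open>m * S + 1\<close>.\<close>
  have term_Pm: "m * e \<le> w + (m * S + 1)" if c: "coeff (P m * a 1) e \<noteq> 0" for e
  proof -
    from c obtain e' where e': "coeff (a 1) e' \<noteq> 0" "e \<le> degree (P m) + e'"
      by (rule coeff_mult_nonzeroE)
    then have "m * e \<le> m * (S + 1 + e')"
      using Pm by (intro mult_le_mono2) (auto simp: S_def)
    then have "m * e \<le> m * S + m + m * e'"
      by (simp add: algebra_simps)
    moreover have "m * e' + (m - 1) \<le> w"
      using has_weightD[OF w _ e'(1)] m by simp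
    ultimately show ?thesis
      using m by simp
  qed
  have term_D: "m * e + (m - j) \<le> w + m * S"
    if j: "j \<in> {1..m}" and c: "coeff (N * euler_deriv (a j)) e \<noteq> 0" for j e
  proof -
    from c obtain e' where e': "coeff (euler_deriv (a j)) e' \<noteq> 0" "e \<le> degree N + e'"
      by (rule coeff_mult_nonzeroE)
    then have "m * e \<le> m * S + m * e'"
      by (intro scale mult_le_mono2) (auto simp: S_def)
    moreover have "m * e' + (m - j) \<le> w"
      using e' by (intro has_weightD[OF w j]) (auto simp: coeff_euler_deriv)
    ultimately show ?thesis
      by simp
  qed
  \<comment> \<open>The extra 1 over \<open>m * S\<close> comes from the shift from position
    \<open>j + 1\<close> to \<open>j\<close>.\<close>
  have term_N: "m * e + (m - j) \<le> w + (m * S + 1)"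
    if j: "j \<in> {1..m - 1}" and c: "coeff (N * a (j + 1)) e \<noteq> 0" for j e
  proof -
    from c obtain e' where e': "coeff (a (j + 1)) e' \<noteq> 0" "e \<le> degree N + e'"
      by (rule coeff_mult_nonzeroE)
    then have "m * e \<le> m * S + m * e'"
      by (intro scale mult_le_mono2) (auto simp: S_def)
    moreover have "m * e' + (m - (j + 1)) \<le> w"
      using j by (intro has_weightD[OF w _ e'(1)]) auto
    ultimately show ?thesis
      using j by auto
  qed
  have upper: "m * e + (m - j) \<le> w + (m * S + 1)"
    if j: "j \<in> {1..m}" and c: "coeff (b j) e \<noteq> 0" for j e
  proof (cases "j = m")
    case True
    then have "coeff (P m * a 1) e \<noteq> 0 \<or> coeff (N * euler_deriv (a m)) e \<noteq> 0"
      using c bm by auto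
    then show ?thesis
      using term_Pm[of e] term_D[of m e] True m by auto
  next
    case False
    then have j': "j \<in> {1..m - 1}"
      using j by auto
    then have "coeff (P j * a 1) e \<noteq> 0 \<or> coeff (N * euler_deriv (a j)) e \<noteq> 0 \<or>
        coeff (N * a (j + 1)) e \<noteq> 0"
      using c bj by auto
    then show ?thesis
      using term_P[OF j', of e] term_D[OF j, of e] term_N[OF j', of e] by linarith
  qed
  obtain p where p: "p \<in> {1..m}" "a p \<noteq> 0" and wp: "m * degree (a p) + (m - p) = w"
    using w by (rule has_weightE)
  have lower: "\<exists>j\<in>{1..m}. \<exists>e. coeff (b j) e \<noteq> 0 \<and> m * e + (m - j) = w + (m * S + 1)"
  proof (cases "p = 1")
    case True
    \<comment> \<open>This is the degree of \<open>P m * a 1\<close>. The derivative term has weight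
      at most \<open>w + m * S\<close> and so cannot reach this exponent.\<close>
    define e where "e = S + 1 + degree (a 1)"
    have me: "m * e = w + (m * S + 1)"
      using wp m True by (simp add: e_def algebra_simps)
    have "coeff (P m * a 1) e = lead_coeff (P m) * lead_coeff (a 1)"
      using coeff_mult_degree_sum[of "P m" "a 1"] Pm by (simp add: e_def S_def)
    moreover have "P m \<noteq> 0"
      using Pm by auto
    moreover have "coeff (N * euler_deriv (a m)) e = 0"
      using term_D[of m e] me m by auto
    ultimately have "coeff (b m) e \<noteq> 0"
      using bm p True by auto
    with me m show ?thesis
      by (intro bexI[of _ m] exI[of _ e]) auto
  next
    case False
    \<comment> \<open>The maximum arrives at position \<open>p - 1\<close> with the leading term of
      \<open>N * a p\<close>; the other two summands are too light to cancel it.\<close>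
    define q e where "q = p - 1" and "e = S + degree (a p)"
    have q: "q \<in> {1..m - 1}" "q \<in> {1..m}" "p = q + 1"
      using False p by (auto simp: q_def)
    have me: "m * e + (m - q) = w + (m * S + 1)"
      using wp q by (auto simp: e_def algebra_simps)
    have "coeff (N * a (q + 1)) e = lead_coeff N * lead_coeff (a p)"
      using coeff_mult_degree_sum[of N "a p"] q by (simp add: e_def S_def)
    moreover have "coeff (N * euler_deriv (a q)) e = 0"
      using term_D[OF q(2), of e] me by auto
    moreover have "coeff (P q * a 1) e = 0"
      using term_P[OF q(1), of e] me by auto
    ultimately have "coeff (b q) e \<noteq> 0"
      using bj[OF q(1)] N p by auto
    with me q show ?thesis
      by blast
  qed
  show ?thesis
    using upper lower unfolding has_weight_def S_def by blast
qed

lemma combination_nonzero: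
  fixes a :: "nat \<Rightarrow> nat \<Rightarrow> 'a::idom poly"
  assumes fin: "finite I" and v: "i \<in> I" "v i \<noteq> 0"
    and w: "\<And>i. i \<in> I \<Longrightarrow> has_weight m (a i) (w i)"
    and dist: "inj_on (\<lambda>i. w i mod m) I"
  shows "\<exists>j\<in>{1..m}. (\<Sum>i\<in>I. v i * a i j) \<noteq> 0"
proof -
  \<comment> \<open>Zero multipliers are discarded, since \<open>W i\<close> is the weight of the
    \<open>i\<close>-th multiplied row only if \<open>v i\<close> is nonzero.\<close>
  define J where "J = {i \<in> I. v i \<noteq> 0}"
  define W where "W i = m * degree (v i) + w i" for i
  have "finite J" "J \<noteq> {}"
    using fin v by (auto simp: J_def)
  then have "Max (W ` J) \<in> W ` J"
    by simp
  then obtain s where s: "s \<in> J" and "Max (W ` J) = W s"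
    by blast
  then have smax: "W i \<le> W s" if "i \<in> J" for i
    using \<open>finite J\<close> that by (metis Max_ge finite_imageI imageI)
  have sI: "s \<in> I" "v s \<noteq> 0"
    using s by (auto simp: J_def)
  obtain p where p: "p \<in> {1..m}" "a s p \<noteq> 0" and wp: "m * degree (a s p) + (m - p) = w s"
    using w[OF sI(1)] by (rule has_weightE)
  define e where "e = degree (v s) + degree (a s p)"
  have We: "W s = m * e + (m - p)"
    using wp by (simp add: W_def e_def algebra_simps)
  \<comment> \<open>Another summand contributing at this place would have \<open>W i\<close> at
    least \<open>W s\<close>, hence equal by maximality, against the distinct residues.\<close>
  have zero: "coeff (v i * a i p) e = 0" if i: "i \<in> I - {s}" for i
  proof (rule ccontr)
    assume c: "coeff (v i * a i p) e \<noteq> 0"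
    then have iJ: "i \<in> J"
      using i by (auto simp: J_def)
    from c obtain e' where e': "coeff (a i p) e' \<noteq> 0" "e \<le> degree (v i) + e'"
      by (rule coeff_mult_nonzeroE)
    have "m * e \<le> m * degree (v i) + m * e'"
      using mult_le_mono2[OF e'(2), of m] by (simp add: algebra_simps)
    moreover have "m * e' + (m - p) \<le> w i"
      using i by (intro has_weightD[OF w p(1) e'(1)]) auto
    ultimately have "W s \<le> W i"
      unfolding We by (simp add: W_def)
    with smax[OF iJ] have "W i = W s"
      by simp
    then have "W i mod m = W s mod m"
      by simp
    then have "w i mod m = w s mod m"
      by (simp add: W_def)
    with dist i sI show False
      by (auto dest: inj_onD)
  qed
  have "coeff (\<Sum>i\<in>I. v i * a i p) e = (\<Sum>i\<in>I. coeff (v i * a i p) e)"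
    by (rule coeff_sum)
  also have "\<dots> = coeff (v s * a s p) e"
    using fin sI zero by (simp add: sum.remove[of I s])
  also have "\<dots> = lead_coeff (v s) * lead_coeff (a s p)"
    using coeff_mult_degree_sum[of "v s" "a s p"] by (simp add: e_def)
  also have "\<dots> \<noteq> 0"
    using sI p by auto
  finally show ?thesis
    using p by (intro bexI[of _ p]) auto
qed

theorem theorem3p1:
  fixes m :: nat
    and N :: "'a::field_char_0 poly"
    and P :: "nat \<Rightarrow> 'a poly"
    and A :: "nat \<Rightarrow> nat \<Rightarrow> 'a poly"
    and k :: nat
  assumes "m \<ge> 2"
    and "N \<noteq> 0"
    and "degree (P m) = degree N + 1"
    and "\<And>j. j \<in> {1..m - 1} \<Longrightarrow> degree (P j) < degree (P m)"
    and "\<exists>j\<in>{1..m}. A 0 j \<noteq> 0"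
    and "\<And>n j. j \<in> {1..m - 1} \<Longrightarrow>
           A (Suc n) j = P j * A n 1 + N * euler_deriv (A n j) + N * A n (j + 1)"
    and "\<And>n. A (Suc n) m = P m * A n 1 + N * euler_deriv (A n m)"
  shows "det (coeff_mat m A k) \<noteq> 0"
proof
  assume det0: "det (coeff_mat m A k) = 0"
  obtain w0 where w0: "has_weight m (A 0) w0"
    using has_weight_exists assms(5) by blast
  have weight: "has_weight m (A n) (w0 + n * (m * degree N + 1))" for n
  proof (induction n)
    case (Suc n)
    have "has_weight m (A (Suc n)) (w0 + n * (m * degree N + 1) + (m * degree N + 1))"
      by (rule has_weight_step[of m N P, OF assms(1-4) assms(6) assms(7) Suc])
    then show ?case
      by (simp add: algebra_simps)
  qed (simp add: w0)
  \<comment> \<open>The multiple of \<open>m\<close> is split off, so that the residue is visibly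
    that of \<open>w0 + k + i\<close>.\<close>
  define w where "w i = w0 + k + i + m * ((k + i) * degree N)" for i
  have w: "has_weight m (A (k + i)) (w i)" for i
    using weight[of "k + i"] by (simp add: w_def algebra_simps)
  have inj: "inj_on (\<lambda>i. w i mod m) {..<m}"
  proof (rule inj_onI)
    fix i j assume ij: "i \<in> {..<m}" "j \<in> {..<m}" "w i mod m = w j mod m"
    then have "(w0 + k + i) mod m = (w0 + k + j) mod m"
      by (simp add: w_def)
    then have "[(w0 + k) + i = (w0 + k) + j] (mod m)"
      by (simp add: cong_def)
    then have "i mod m = j mod m"
      by (simp only: cong_add_lcancel_nat) (simp add: cong_def)
    with ij show "i = j"
      by simp
  qed
  let ?M = "coeff_mat m A k"
  have M: "?M \<in> carrier_mat m m"
    by (simp add: coeff_mat_def)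
  \<comment> \<open>A kernel vector of the transpose is a relation among the rows; over the domain
    of polynomials its entries can be taken polynomial.\<close>
  have "det (transpose_mat ?M) = 0"
    using det0 det_transpose[OF M] by simp
  then obtain v where v: "v \<in> carrier_vec m" "v \<noteq> 0\<^sub>v m" "transpose_mat ?M *\<^sub>v v = 0\<^sub>v m"
    using det_0_iff_vec_prod_zero[of "transpose_mat ?M" m] M by auto
  obtain i where i: "i \<in> {..<m}" "v $ i \<noteq> 0"
    using v(1,2) by (metis carrier_vecD eq_vecI index_zero_vec lessThan_iff)
  obtain j where j: "j \<in> {1..m}" "(\<Sum>i<m. v $ i * A (k + i) j) \<noteq> 0"
    using combination_nonzero[of "{..<m}" i "\<lambda>i. v $ i" m "\<lambda>i. A (k + i)" w] i w inj by auto
  \<comment> \<open>Vector indices start at 0, whereas positions \<open>j\<close> start at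
    1.\<close>
  have "(transpose_mat ?M *\<^sub>v v) $ (j - 1) = (\<Sum>i<m. v $ i * A (k + i) j)"
    using j(1) v(1)
    by (auto simp: coeff_mat_def scalar_prod_def mult.commute lessThan_atLeast0 intro!: sum.cong)
  with v(3) j show False
    by auto
qed

end
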